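(* For bijective structures, and presentations with a single generator $a$ and two identities, the sentence $\varphi$ saying that the structure is a $1$-cycle (i.e., has exactly one element) does not have a limiting density.
   Context: The language has two unary function symbols $S,S^{-1}$. The variety of bijective structures has axioms $(\forall x)\,SS^{-1}(x)=x$ and $(\forall x)\,S^{-1}S(x)=x$; let $T$ be the theory generated by these. A presentation here consists of a generator $a$ and an unordered set of two distinct identities, each of the form $t(a)=a$, where $t$ is an arbitrary (possibly empty, not necessarily reduced) finite string of the symbols $S,S^{-1}$. The resulting structure is the bijective structure generated by $a$ in which the equations between closed terms in $a$ that hold are exactly those that follow logically from $T$ and the two identities. The length of an identity $t(a)=a$ is the number of function symbols in $t$. Let $P_s$ be the number of presentations in which both identities have length at most $s$ and $P_s(\varphi)$ the number of these whose resulting structure satisfies $\varphi$. The limiting density of $\varphi$ is $\lim_{s\to\infty}P_s(\varphi)/P_s$, if this limit exists. *)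

theory Defs
  imports Complex_Main
begin

datatype symb = S | Sinv

datatype trm = Var nat | Gen | App symb trm

fun closed_trm :: "trm \<Rightarrow> bool" where
  "closed_trm (Var n) = False"
| "closed_trm Gen = True"
| "closed_trm (App f t) = closed_trm t"

fun subst :: "(nat \<Rightarrow> trm) \<Rightarrow> trm \<Rightarrow> trm" where
  "subst \<sigma> (Var n) = \<sigma> n"
| "subst \<sigma> Gen = Gen"
| "subst \<sigma> (App f t) = App f (subst \<sigma> t)"

text \<open>A pair \<open>(s, t)\<close> stands for the universally quantified equation \<open>s = t\<close>.\<close>

type_synonym eqn = "trm \<times> trm"

definition bij_theory :: "eqn set" where
  "bij_theory = {(App S (App Sinv (Var 0)), Var 0), (App Sinv (App S (Var 0)), Var 0)}"

text \<open>Logical consequence between equations, given by Birkhoff's sound and complete calculus;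
  derivability avoids a quantification over models of all types.\<close>

inductive entails :: "eqn set \<Rightarrow> trm \<Rightarrow> trm \<Rightarrow> bool" for E :: "eqn set" where
  ax: "(s, t) \<in> E \<Longrightarrow> entails E (subst \<sigma> s) (subst \<sigma> t)"
| refl: "entails E t t"
| sym: "entails E s t \<Longrightarrow> entails E t s"
| trans: "entails E s t \<Longrightarrow> entails E t u \<Longrightarrow> entails E s u"
| cong: "entails E s t \<Longrightarrow> entails E (App f s) (App f t)"

record 'm struct =
  carrier :: "'m set"
  opn :: "symb \<Rightarrow> 'm \<Rightarrow> 'm"
  gen :: 'm

definition closed_rel :: "eqn set \<Rightarrow> (trm \<times> trm) set" where
  "closed_rel E = {(s, t). closed_trm s \<and> closed_trm t \<and> entails E s t}"

text \<open>The structure generated by \<open>a\<close> subject to \<open>E\<close>: closed terms modulo \<open>E\<close>-provable equality.\<close>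

definition term_struct :: "eqn set \<Rightarrow> trm set struct" where
  "term_struct E =
    \<lparr> carrier = {t. closed_trm t} // closed_rel E,
      opn = (\<lambda>f X. closed_rel E `` (App f ` X)),
      gen = closed_rel E `` {Gen} \<rparr>"

text \<open>The identity \<open>t(a) = a\<close>, for a string \<open>t\<close> written with its outermost symbol first.\<close>

definition identity :: "symb list \<Rightarrow> eqn" where
  "identity w = (foldr App w Gen, Gen)"

definition presentations :: "nat \<Rightarrow> eqn set set" where
  "presentations s = {I. I \<subseteq> identity ` {w. length w \<le> s} \<and> card I = 2}"

definition presented_struct :: "eqn set \<Rightarrow> trm set struct" where
  "presented_struct I = term_struct (bij_theory \<union> I)"

datatype fm = Eq trm trm | Neg fm | Conj fm fm | All nat fm

fun val :: "'m struct \<Rightarrow> (nat \<Rightarrow> 'm) \<Rightarrow> trm \<Rightarrow> 'm" where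
  "val M e (Var n) = e n"
| "val M e Gen = gen M"
| "val M e (App f t) = opn M f (val M e t)"

fun sat :: "'m struct \<Rightarrow> (nat \<Rightarrow> 'm) \<Rightarrow> fm \<Rightarrow> bool" where
  "sat M e (Eq s t) \<longleftrightarrow> val M e s = val M e t"
| "sat M e (Neg \<phi>) \<longleftrightarrow> \<not> sat M e \<phi>"
| "sat M e (Conj \<phi> \<psi>) \<longleftrightarrow> sat M e \<phi> \<and> sat M e \<psi>"
| "sat M e (All n \<phi>) \<longleftrightarrow> (\<forall>x\<in>carrier M. sat M (e(n := x)) \<phi>)"

definition models :: "'m struct \<Rightarrow> fm \<Rightarrow> bool" where
  "models M \<phi> \<longleftrightarrow> (\<forall>e. range e \<subseteq> carrier M \<longrightarrow> sat M e \<phi>)"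

text \<open>\<open>\<exists>x. \<forall>y. y = x\<close>\<close>

definition one_cycle :: fm where
  "one_cycle = Neg (All 0 (Neg (All 1 (Eq (Var 1) (Var 0)))))"

lemma models_one_cycle_iff:
  assumes "gen M \<in> carrier M"
  shows "models M one_cycle \<longleftrightarrow> (\<exists>!x. x \<in> carrier M)"
proof -
  have "range (\<lambda>_::nat. gen M) \<subseteq> carrier M"
    using assms by auto
  moreover have "sat M e one_cycle \<longleftrightarrow> (\<exists>!x. x \<in> carrier M)" for e
    unfolding one_cycle_def by simp (metis (full_types))
  ultimately show ?thesis
    unfolding models_def by blast
qed

definition density_upto :: "fm \<Rightarrow> nat \<Rightarrow> real" where
  "density_upto \<phi> s =
    real (card {I \<in> presentations s. models (presented_struct I) \<phi>}) / real (card (presentations s))"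

definition has_limiting_density :: "fm \<Rightarrow> bool" where
  "has_limiting_density \<phi> \<longleftrightarrow> (\<exists>d. density_upto \<phi> \<longlonglongrightarrow> d)"

end

theory Submission
  imports Defs
begin

text \<open>The presented structure is \<open>\<int>/g\<close>, where \<open>g\<close> is the gcd of the exponent sums of the two words,
  so it is a 1-cycle iff \<open>g = 1\<close>. An exponent sum has the parity of the word length. Among words
  of length at most \<open>s\<close>, the even lengths have proportion about \<open>2/3\<close> for even \<open>s\<close>, and exactly
  \<open>1/3\<close> for odd \<open>s\<close>. Along even \<open>s\<close> the density is therefore at most \<open>1 - 4/9 = 5/9\<close>. Along odd
  \<open>s\<close>, a failing pair is either even (proportion at most \<open>1/9\<close>) or has an odd common divisor
  \<open>d \<ge> 3\<close>. Unimodality of the binomial coefficients bounds the proportion of words whose exponent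
  sum is divisible by \<open>d\<close> by \<open>1/d + O(1/\<surd>s)\<close>. Chebyshev's inequality lets one restrict to
  \<open>d = O(\<surd>s)\<close>, and \<open>\<Sum> 1/d\<^sup>2 \<le> 1/4\<close> over odd \<open>d \<ge> 3\<close>. This keeps the density above \<open>0.6\<close>
  infinitely often.\<close>

subsection \<open>Presented structures and exponent sums\<close>

fun step :: "symb \<Rightarrow> int" where
  "step S = 1"
| "step Sinv = -1"

definition exponent :: "symb list \<Rightarrow> int" where
  "exponent w = (\<Sum>x\<leftarrow>w. step x)"

text \<open>The value of a term in the integers, where \<open>S\<close> and \<open>Sinv\<close> are
  the translations by 1 and -1, the generator is 0 and \<open>e\<close> places the
  variables.\<close>

fun height :: "(nat \<Rightarrow> int) \<Rightarrow> trm \<Rightarrow> int" where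
  "height e (Var n) = e n"
| "height e Gen = 0"
| "height e (App f t) = step f + height e t"

lemma exponent_Nil [simp]: "exponent [] = 0"
  and exponent_Cons [simp]: "exponent (x # w) = step x + exponent w"
  by (simp_all add: exponent_def)

lemma height_subst: "height e (subst \<sigma> t) = height (\<lambda>n. height e (\<sigma> n)) t"
  by (induction t) auto

lemma height_foldr_App: "height e (foldr App w t) = exponent w + height e t"
  by (induction w) auto

lemma closed_subst: "closed_trm t \<Longrightarrow> subst \<sigma> t = t"
  by (induction t) auto

lemma closed_foldr_App [simp]: "closed_trm (foldr App w t) \<longleftrightarrow> closed_trm t"
  by (induction w) auto

lemma closed_trm_foldr:
  assumes "closed_trm t"
  obtains w where "t = foldr App w Gen"
proof -
  have "\<exists>w. t = foldr App w Gen"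
    using assms
  proof (induction t)
    case (App f t)
    then obtain w where "t = foldr App w Gen" by auto
    then have "App f t = foldr App (f # w) Gen" by simp
    then show ?case by blast
  next
    case Gen
    have "Gen = foldr App [] Gen" by simp
    then show ?case by blast
  qed simp
  then show thesis using that by blast
qed

lemma inj_identity: "inj identity"
proof -
  have "foldr App v Gen = foldr App w Gen \<Longrightarrow> v = w" for v w
  proof (induction v arbitrary: w)
    case Nil
    then show ?case by (cases w) auto
  next
    case (Cons x v)
    then show ?case by (cases w) auto
  qed
  then show ?thesis by (auto simp: inj_def identity_def)
qed

text \<open>Soundness of the calculus for the cyclic model of integers modulo \<open>g\<close>. The
  hypothesis ranges over all \<open>e\<close> because an axiom instance turns the substitution into
  a new placement of the variables; the two cancellation axioms preserve \<open>height\<close>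
  exactly.\<close>

lemma entails_height_cong:
  assumes "entails (bij_theory \<union> I) s t"
    and "\<And>l r e. (l, r) \<in> I \<Longrightarrow> g dvd height e l - height e r"
  shows "g dvd height e s - height e t"
  using assms(1)
proof (induction)
  case (ax s t \<sigma>)
  then consider "(s, t) \<in> I" | "(s, t) \<in> bij_theory" by blast
  then show ?case
    by cases (auto simp: height_subst assms(2) bij_theory_def)
next
  case (sym s t)
  then show ?case by (metis dvd_minus_iff minus_diff_eq)
next
  case (trans s t u)
  then show ?case using dvd_add[of g "height e s - height e t" "height e t - height e u"] by simp
qed auto

lemma entails_cancel:
  assumes "bij_theory \<subseteq> E"
  shows "entails E (App S (App Sinv t)) t" and "entails E (App Sinv (App S t)) t"
proof -
  have "(App S (App Sinv (Var 0)), Var 0) \<in> E" "(App Sinv (App S (Var 0)), Var 0) \<in> E"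
    using assms by (auto simp: bij_theory_def)
  from this[THEN entails.ax, where \<sigma> = "\<lambda>_. t"]
  show "entails E (App S (App Sinv t)) t" and "entails E (App Sinv (App S t)) t" by simp_all
qed

lemma entails_foldr_cong:
  "entails E s t \<Longrightarrow> entails E (foldr App w s) (foldr App w t)"
  by (induction w) (auto intro: entails.cong)

text \<open>The reduced term with exponent sum \<open>k\<close>, which serves as normal form for
  closed terms.\<close>

definition power_trm :: "int \<Rightarrow> trm" where
  "power_trm k = foldr App (if k \<ge> 0 then replicate (nat k) S else replicate (nat (-k)) Sinv) Gen"

lemma power_trm_nonneg: "power_trm (int n) = foldr App (replicate n S) Gen"
  and power_trm_neg: "power_trm (- int n) = foldr App (replicate n Sinv) Gen"
  by (auto simp: power_trm_def)

text \<open>A symbol either lengthens a normal form of its own sign or cancels against the outermost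
  symbol of the opposite sign.\<close>

lemma entails_App_power_trm:
  assumes "bij_theory \<subseteq> E"
  shows "entails E (App f (power_trm k)) (power_trm (step f + k))"
proof (cases f; cases k rule: int_cases2)
  fix n assume f: "f = S" and k: "k = int n"
  have "step f + k = int (Suc n)" using f k by simp
  then show ?thesis unfolding f k by (simp only: power_trm_nonneg) (simp add: entails.refl)
next
  fix n assume f: "f = S" and k: "k = - int n"
  show ?thesis
  proof (cases n)
    case 0
    \<comment> \<open>At 0 both signs describe the term \<open>Gen\<close>; reading \<open>k\<close>
      with the sign of \<open>f\<close> turns this case into lengthening.\<close>
    then have "k = int 0" "step f + k = int (Suc 0)" using f k by simp_all
    then show ?thesis unfolding f by (simp only: power_trm_nonneg) (simp add: entails.refl)
  next
    case (Suc m)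
    then have "step f + k = - int m" using f k by simp
    then show ?thesis unfolding f k Suc
      by (simp only: power_trm_neg) (simp add: entails_cancel[OF assms])
  qed
next
  fix n assume f: "f = Sinv" and k: "k = - int n"
  have "step f + k = - int (Suc n)" using f k by simp
  then show ?thesis unfolding f k by (simp only: power_trm_neg) (simp add: entails.refl)
next
  fix n assume f: "f = Sinv" and k: "k = int n"
  show ?thesis
  proof (cases n)
    case 0
    then have "k = - int 0" "step f + k = - int (Suc 0)" using f k by simp_all
    then show ?thesis unfolding f by (simp only: power_trm_neg) (simp add: entails.refl)
  next
    case (Suc m)
    then have "step f + k = int m" using f k by simp
    then show ?thesis unfolding f k Suc
      by (simp only: power_trm_nonneg) (simp add: entails_cancel[OF assms])
  qed
qed

lemma entails_power_trm:
  assumes "bij_theory \<subseteq> E"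
  shows "entails E (foldr App w Gen) (power_trm (exponent w))"
proof (induction w)
  case Nil
  show ?case by (simp add: power_trm_def entails.refl)
next
  case (Cons x w)
  then show ?case
    using entails.cong entails.trans entails_App_power_trm[OF assms] by fastforce
qed

lemma entails_exponent_eq:
  assumes "bij_theory \<subseteq> E" "exponent v = exponent w"
  shows "entails E (foldr App v Gen) (foldr App w Gen)"
  using assms entails_power_trm entails.sym entails.trans by metis

lemma exponent_append [simp]: "exponent (v @ w) = exponent v + exponent w"
  by (simp add: exponent_def)

lemma ex_exponent: "\<exists>w. exponent w = k"
proof -
  have "exponent (replicate n S) = int n" "exponent (replicate n Sinv) = - int n" for n
    by (induction n) auto
  then show ?thesis by (metis int_cases2)
qed

text \<open>Having one element means that every closed term is provably equal to \<open>Gen\<close>.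
  If so, soundness applied to the equation of \<open>App S Gen\<close> with \<open>Gen\<close> makes
  the gcd divide 1. Conversely, the exponents of words provably trivial at \<open>Gen\<close> form a
  subgroup of the integers, which contains 1 by Bezout.\<close>

lemma one_cycle_iff_gcd:
  "models (presented_struct {identity u, identity v}) one_cycle
    \<longleftrightarrow> gcd (exponent u) (exponent v) = 1"
proof -
  define E where "E = bij_theory \<union> {identity u, identity v}"
  define R where "R = closed_rel E"
  have bij: "bij_theory \<subseteq> E" unfolding E_def by (rule Un_upper1)
  have equiv: "equiv {t. closed_trm t} R"
    unfolding R_def closed_rel_def equiv_def refl_on_def sym_def trans_def
    by (auto intro: entails.refl entails.sym entails.trans)
  have carrier: "carrier (presented_struct {identity u, identity v}) = {t. closed_trm t} // R"
    and "gen (presented_struct {identity u, identity v}) = R `` {Gen}"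
    by (simp_all add: presented_struct_def term_struct_def E_def R_def)
  then have mod: "models (presented_struct {identity u, identity v}) one_cycle
      \<longleftrightarrow> (\<exists>!x. x \<in> {t. closed_trm t} // R)"
    by (subst models_one_cycle_iff) (simp_all add: quotientI)
  also have "\<dots> \<longleftrightarrow> (\<forall>t. closed_trm t \<longrightarrow> entails E t Gen)"
  proof
    assume ex1: "\<exists>!x. x \<in> {t. closed_trm t} // R"
    show "\<forall>t. closed_trm t \<longrightarrow> entails E t Gen"
    proof (intro allI impI)
      fix t assume t: "closed_trm t"
      have "R `` {t} \<in> {t. closed_trm t} // R" "R `` {Gen} \<in> {t. closed_trm t} // R"
        using t by (simp_all add: quotientI)
      with ex1 have "R `` {t} = R `` {Gen}" by blast
      then have "(t, Gen) \<in> R" using eq_equiv_class[OF _ equiv] by simp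
      then show "entails E t Gen" by (simp add: R_def closed_rel_def)
    qed
  next
    assume all: "\<forall>t. closed_trm t \<longrightarrow> entails E t Gen"
    have "x = R `` {Gen}" if x: "x \<in> {t. closed_trm t} // R" for x
    proof -
      from x obtain t where t: "closed_trm t" "x = R `` {t}" by (auto elim: quotientE)
      then have "(t, Gen) \<in> R" using all by (simp add: R_def closed_rel_def)
      then show ?thesis using equiv_class_eq[OF equiv] t by blast
    qed
    moreover have "R `` {Gen} \<in> {t. closed_trm t} // R" by (simp add: quotientI)
    ultimately show "\<exists>!x. x \<in> {t. closed_trm t} // R" by blast
  qed
  also have "\<dots> \<longleftrightarrow> gcd (exponent u) (exponent v) = 1"
  proof
    assume all: "\<forall>t. closed_trm t \<longrightarrow> entails E t Gen"
    then have "entails E (App S Gen) Gen" by simp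
    then have "gcd (exponent u) (exponent v) dvd height (\<lambda>_. 0) (App S Gen) - height (\<lambda>_. 0) Gen"
      unfolding E_def
      by (rule entails_height_cong) (auto simp: identity_def height_foldr_App)
    then show "gcd (exponent u) (exponent v) = 1" by simp
  next
    assume gcd: "gcd (exponent u) (exponent v) = 1"
    define H where "H = {exponent w |w. entails E (foldr App w Gen) Gen}"
    \<comment> \<open>Whether a word fixes the generator depends only on its exponent, so membership
      in \<open>H\<close> may be witnessed by any word.\<close>
    have in_H: "entails E (foldr App w Gen) Gen" if "exponent w \<in> H" for w
      using that entails_exponent_eq[OF bij] entails.trans by (fastforce simp: H_def)
    have "entails E (foldr App u Gen) Gen" "entails E (foldr App v Gen) Gen"
      using entails.ax[of "foldr App u Gen" Gen E Var] entails.ax[of "foldr App v Gen" Gen E Var]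
      by (simp_all add: E_def identity_def closed_subst)
    then have uv: "exponent u \<in> H" "exponent v \<in> H" by (auto simp: H_def)
    have add: "k + l \<in> H" if kl: "k \<in> H" "l \<in> H" for k l
    proof -
      from kl obtain a b where a: "entails E (foldr App a Gen) Gen" "k = exponent a"
        and b: "entails E (foldr App b Gen) Gen" "l = exponent b" by (auto simp: H_def)
      have "entails E (foldr App (a @ b) Gen) Gen"
        using entails_foldr_cong[OF b(1), of a] a(1) entails.trans by fastforce
      then show ?thesis unfolding H_def a b by (auto intro!: exI[of _ "a @ b"])
    qed
    have neg: "- k \<in> H" if k: "k \<in> H" for k
    proof -
      from k obtain a where a: "entails E (foldr App a Gen) Gen" "k = exponent a"
        by (auto simp: H_def)
      obtain b where b: "exponent b = - k" using ex_exponent by blast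
      \<comment> \<open>Inverses: insert \<open>a\<close> under \<open>b\<close>, where it is
        provably trivial; the word \<open>b @ a\<close> has exponent 0 and collapses to
        \<open>Gen\<close>.\<close>
      have "entails E (foldr App b Gen) (foldr App (b @ a) Gen)"
        using entails_foldr_cong[OF entails.sym[OF a(1)], of b] by simp
      moreover have "entails E (foldr App (b @ a) Gen) (foldr App [] Gen)"
        by (rule entails_exponent_eq[OF bij]) (simp add: a b)
      ultimately have "entails E (foldr App b Gen) Gen" by (auto intro: entails.trans)
      then show ?thesis unfolding H_def using b by (auto intro!: exI[of _ b])
    qed
    have "exponent u + - exponent u \<in> H" using add neg uv by blast
    then have zero: "0 \<in> H" by simp
    have nat_mult: "int n * k \<in> H" if "k \<in> H" for n k
      by (induction n) (auto simp: zero algebra_simps intro: add that)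
    have mult: "m * k \<in> H" if "k \<in> H" for m k
      using that nat_mult[OF that] neg by (cases m rule: int_cases2) auto
    obtain x y where "x * exponent u + y * exponent v = 1"
      using bezout_int gcd by metis
    then have one: "1 \<in> H" using add[OF mult[OF uv(1), of x] mult[OF uv(2), of y]] by simp
    show "\<forall>t. closed_trm t \<longrightarrow> entails E t Gen"
    proof (intro allI impI)
      fix t assume "closed_trm t"
      then obtain w where "t = foldr App w Gen" by (rule closed_trm_foldr)
      then show "entails E t Gen" using in_H mult[OF one, of "exponent w"] by simp
    qed
  qed
  finally show ?thesis .
qed

subsection \<open>Counting words by exponent\<close>

definition words :: "nat \<Rightarrow> symb list set" where
  "words n = {w. length w = n}"

definition words_upto :: "nat \<Rightarrow> symb list set" where
  "words_upto s = {w. length w \<le> s}"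

lemma UNIV_symb: "(UNIV :: symb set) = {S, Sinv}"
  using symb.exhaust by blast

lemma finite_words_upto [simp]: "finite (words_upto s)"
proof -
  have "finite (UNIV :: symb set)" by (simp add: UNIV_symb)
  from finite_lists_length_le[OF this, of s] show ?thesis by (simp add: words_upto_def)
qed

lemma finite_words [simp]: "finite (words n)"
  by (rule finite_subset[OF _ finite_words_upto[of n]]) (auto simp: words_def words_upto_def)

lemma words_0: "words 0 = {[]}"
  by (auto simp: words_def)

lemma sum_words_Suc:
  "(\<Sum>w\<in>words (Suc n). f w) = (\<Sum>w\<in>words n. f (S # w) + f (Sinv # w))"
proof -
  have "words (Suc n) = (#) S ` words n \<union> (#) Sinv ` words n"
    using UNIV_symb by (fastforce simp: words_def length_Suc_conv)
  moreover have "(#) S ` words n \<inter> (#) Sinv ` words n = {}" by auto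
  ultimately show ?thesis
    by (simp add: sum.union_disjoint sum.reindex sum.distrib)
qed

lemma sum_words_upto: "(\<Sum>w\<in>words_upto s. f w) = (\<Sum>n\<le>s. \<Sum>w\<in>words n. f w)"
proof -
  have "words_upto s = (\<Union>n\<le>s. words n)" by (auto simp: words_upto_def words_def)
  then show ?thesis by (simp only:) (subst sum.UNION_disjoint, auto simp: words_def[symmetric], auto simp: words_def)
qed

lemma card_filter_eq_sum:
  "finite A \<Longrightarrow> card {x \<in> A. P x} = (\<Sum>x\<in>A. of_bool (P x))"
  by (simp add: Int_def)

lemma card_words: "card (words n) = 2 ^ n"
proof (induction n)
  case 0
  show ?case by (simp add: words_0)
next
  case (Suc n)
  then show ?case using sum_words_Suc[of "\<lambda>_. 1::nat" n] by simp
qed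

lemma card_words_upto: "card (words_upto s) = 2 ^ Suc s - 1"
proof -
  have "card (words_upto s) = (\<Sum>n\<le>s. 2 ^ n)"
    using sum_words_upto[of "\<lambda>_. 1::nat" s] by (simp add: card_words)
  also have "Suc (\<Sum>n\<le>s. 2 ^ n) = 2 ^ Suc s" by (induction s) auto
  then have "(\<Sum>n\<le>s. 2 ^ n :: nat) = 2 ^ Suc s - 1" by simp
  finally show ?thesis .
qed

text \<open>Splitting off the first letter reproduces Pascal's rule.\<close>

lemma card_words_count: "card {w \<in> words n. count_list w S = k} = n choose k"
proof (induction n arbitrary: k)
  case 0
  have "{w. w = [] \<and> count_list w S = 0} = {[]}" by force
  then show ?case
    unfolding card_filter_eq_sum[OF finite_words] words_0 by (cases k) simp_all
next
  case (Suc n)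
  have "card {w \<in> words (Suc n). count_list w S = k}
      = (\<Sum>w\<in>words n. of_bool (Suc (count_list w S) = k)) + (\<Sum>w\<in>words n. of_bool (count_list w S = k))"
    unfolding card_filter_eq_sum[OF finite_words] sum_words_Suc
    by (simp only: sum.distrib count_list.simps simp_thms symb.distinct if_True if_False add_Suc_right Suc_eq_plus1)
  also have "\<dots> = card {w \<in> words n. Suc (count_list w S) = k} + card {w \<in> words n. count_list w S = k}"
    unfolding card_filter_eq_sum[OF finite_words] ..
  also have "\<dots> = (Suc n choose k)"
    by (cases k) (simp_all add: Suc)
  finally show ?case .
qed

lemma exponent_eq_count: "exponent w = 2 * int (count_list w S) - int (length w)"
proof (induction w)
  case (Cons x w)
  then show ?case by (cases x) auto
qed simp

lemma card_words_dvd_exponent: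
  "card {w \<in> words n. d dvd exponent w} = (\<Sum>k | k \<le> n \<and> d dvd 2 * int k - int n. n choose k)"
proof -
  have "{w \<in> words n. d dvd exponent w}
      = (\<Union>k\<in>{k. k \<le> n \<and> d dvd 2 * int k - int n}. {w \<in> words n. count_list w S = k})"
    by (auto simp: words_def exponent_eq_count count_le_length)
  then show ?thesis
    by (simp only:) (subst card_UN_disjoint, auto simp: card_words_count)
qed

text \<open>The second moment of a simple random walk: the first letter replaces \<open>x^2\<close>
  by \<open>(x + 1)^2 + (x - 1)^2 = 2 * x^2 + 2\<close>.\<close>

lemma sum_exponent_squared: "(\<Sum>w\<in>words n. (exponent w)\<^sup>2) = int n * 2 ^ n"
proof (induction n)
  case 0
  show ?case by (simp add: words_0)
next
  case (Suc n)
  have "(\<Sum>w\<in>words (Suc n). (exponent w)\<^sup>2) = (\<Sum>w\<in>words n. 2 * (exponent w)\<^sup>2 + 2)"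
    unfolding sum_words_Suc by (intro sum.cong) (auto simp: power2_eq_square algebra_simps)
  also have "\<dots> = int (Suc n) * 2 ^ Suc n"
    using Suc by (simp add: sum.distrib sum_distrib_left[symmetric] card_words algebra_simps)
  finally show ?case .
qed

text \<open>Chebyshev's inequality; words of length \<open>n\<close> have mean square exponent
  \<open>n\<close>, which is at most \<open>s\<close>.\<close>

lemma card_large_exponent:
  "r\<^sup>2 * real (card {w \<in> words_upto s. \<bar>exponent w\<bar> > r}) \<le> real s * real (card (words_upto s))"
  if "r \<ge> 0" for r :: real
proof -
  have "r\<^sup>2 * real (card {w \<in> words_upto s. \<bar>exponent w\<bar> > r})
      = (\<Sum>w\<in>words_upto s. if \<bar>exponent w\<bar> > r then r\<^sup>2 else 0)"
    by (subst sum.inter_filter[symmetric]) simp_all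
  also have "\<dots> \<le> (\<Sum>w\<in>words_upto s. real_of_int ((exponent w)\<^sup>2))"
  proof (intro sum_mono)
    fix w
    show "(if \<bar>exponent w\<bar> > r then r\<^sup>2 else 0) \<le> real_of_int ((exponent w)\<^sup>2)"
      using that power_mono[of r "\<bar>real_of_int (exponent w)\<bar>" 2] by auto
  qed
  also have "\<dots> = real_of_int (\<Sum>n\<le>s. int n * 2 ^ n)"
    by (simp only: of_int_sum[symmetric] sum_words_upto sum_exponent_squared)
  also have "\<dots> \<le> real_of_int (\<Sum>n\<le>s. int s * 2 ^ n)"
    by (intro of_int_le_iff[THEN iffD2] sum_mono mult_right_mono) auto
  also have "\<dots> = real s * real (card (words_upto s))"
    using sum_words_upto[of "\<lambda>_. 1::nat" s] by (simp add: card_words sum_distrib_left)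
  finally show ?thesis .
qed

section \<open>Binomial coefficients along arithmetic progressions\<close>

text \<open>Since \<open>g\<close> decreases, each term after the first is at most the average over
  the \<open>d\<close> indices just before it, and these blocks are disjoint. Only the first term is
  charged to \<open>g 0\<close>.\<close>

lemma sum_antimono_progression:
  fixes g :: "nat \<Rightarrow> nat"
  assumes "antimono g"
  shows "d * (\<Sum>t<T. g (r + d * t)) \<le> d * g 0 + (\<Sum>j<r + d * T. g j)"
proof -
  \<comment> \<open>The induction compares one more term on the left with the same right-hand side,
    since each term is paid for by the preceding block.\<close>
  have "d * (\<Sum>t<Suc T. g (r + d * t)) \<le> d * g 0 + (\<Sum>j<r + d * T. g j)" for T
  proof (induction T)
    case 0
    have "g r \<le> g 0" by (rule antimonoD[OF assms]) simp
    then show ?case by (simp add: trans_le_add1)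
  next
    case (Suc T)
    have "d * g (r + d * Suc T) \<le> (\<Sum>j\<in>{r + d * T..<r + d * Suc T}. g j)"
      using sum_bounded_below[of "{r + d * T..<r + d * Suc T}" "g (r + d * Suc T)" g]
        antimonoD[OF assms, of _ "r + d * Suc T"] by simp
    moreover have "(\<Sum>j<r + d * Suc T. g j)
        = (\<Sum>j<r + d * T. g j) + (\<Sum>j\<in>{r + d * T..<r + d * Suc T}. g j)"
      using sum.atLeastLessThan_concat[of 0 "r + d * T" "r + d * Suc T" g]
      by (simp add: atLeast0LessThan)
    ultimately show ?case using Suc by (simp add: distrib_left)
  qed
  from this[of T] show ?thesis by (simp add: distrib_left)
qed

text \<open>By the symmetry \<open>k \<mapsto> n - k\<close> it suffices to treat the upper half, where the binomial
  coefficients decrease.\<close>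

lemma sum_binomial_progression:
  fixes d :: nat
  assumes "odd d"
  shows "d * (\<Sum>k | k \<le> n \<and> int d dvd 2 * int k - int n. n choose k)
    \<le> 2 ^ n + 3 * d * (n choose (n div 2))"
proof -
  define h where "h = n - n div 2"
  define K where "K = {k. k \<le> n \<and> int d dvd 2 * int k - int n}"
  define g where "g j = n choose (h + j)" for j
  have finK [simp]: "finite K" by (simp add: K_def)
  have d: "d \<ge> 1" using assms by (cases d) auto
  have g0: "g 0 = n choose (n div 2)"
    using binomial_symmetric[of "n div 2" n] by (simp add: g_def h_def)
  have "antimono g"
  proof (rule antimonoI)
    fix i j :: nat assume "i \<le> j"
    then show "g j \<le> g i"
      using binomial_antimono[of "h + i" "h + j" n]
      by (cases "h + j \<le> n") (simp_all add: g_def h_def binomial_eq_0)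
  qed
  have refl: "n - k \<in> K" if "k \<in> K" for k
  proof -
    have "2 * int (n - k) - int n = - (2 * int k - int n)" using that by (auto simp: K_def)
    then show ?thesis using that
      by (simp only: K_def mem_Collect_eq dvd_minus_iff) simp
  qed
  have half: "(\<Sum>k\<in>K. n choose k) \<le> 2 * (\<Sum>k\<in>K \<inter> {h..}. n choose k)"
  proof -
    \<comment> \<open>Every index below \<open>h\<close> is the reflection of one in the upper half.
      The middle index may be counted twice, hence only an inequality.\<close>
    have "K \<subseteq> (K \<inter> {h..}) \<union> (\<lambda>k. n - k) ` (K \<inter> {h..})"
    proof
      fix k assume k: "k \<in> K"
      show "k \<in> (K \<inter> {h..}) \<union> (\<lambda>k. n - k) ` (K \<inter> {h..})"
      proof (cases "h \<le> k")
        case False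
        then have "n - k \<in> K \<inter> {h..}" "n - (n - k) = k"
          using refl[OF k] k by (auto simp: h_def K_def)
        then show ?thesis by (metis UnI2 image_eqI)
      qed (use k in simp)
    qed
    then have "(\<Sum>k\<in>K. n choose k)
        \<le> (\<Sum>k\<in>(K \<inter> {h..}) \<union> (\<lambda>k. n - k) ` (K \<inter> {h..}). n choose k)"
      by (intro sum_mono2) auto
    also have "\<dots> \<le> (\<Sum>k\<in>K \<inter> {h..}. n choose k) + (\<Sum>k\<in>(\<lambda>k. n - k) ` (K \<inter> {h..}). n choose k)"
      by (simp add: sum_Un_nat)
    also have "(\<Sum>k\<in>(\<lambda>k. n - k) ` (K \<inter> {h..}). n choose k) = (\<Sum>k\<in>K \<inter> {h..}. n choose k)"
      by (subst sum.reindex)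
        (auto simp: K_def inj_on_def binomial_symmetric[symmetric] intro!: sum.cong)
    finally show ?thesis by simp
  qed
  obtain r where r: "K \<inter> {h..} \<subseteq> (\<lambda>t. h + (r + d * t)) ` {..<Suc n}"
  proof -
    \<comment> \<open>With \<open>k = h + j\<close>, the number \<open>2 * k - n\<close> is
      \<open>2 * j\<close> for even \<open>n\<close> and \<open>2 * j + 1\<close> for odd
      \<open>n\<close>. As \<open>d\<close> is odd, divisibility by \<open>d\<close> forces
      \<open>j\<close> to be congruent to 0 or to \<open>(d - 1) / 2\<close> modulo
      \<open>d\<close>.\<close>
    define r where "r = (if even n then 0 else d div 2)"
    have "k \<in> (\<lambda>t. h + (r + d * t)) ` {..<Suc n}" if k: "k \<in> K" "h \<le> k" for k
    proof -
      obtain j where j: "k = h + j" using k(2) le_Suc_ex by blast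
      have "\<exists>t. j = r + d * t"
      proof (cases "even n")
        case True
        then have "2 * int k - int n = 2 * int j" using j by (auto simp: h_def)
        then have "int d dvd 2 * int j" using k(1) by (simp add: K_def)
        then have "d dvd j" using assms
          by (simp add: coprime_dvd_mult_right_iff)
        then show ?thesis using True by (auto simp: r_def)
      next
        case False
        then have "2 * int k - int n = int (2 * j + 1)" using j by (auto simp: h_def elim!: oddE)
        then have "int d dvd int (2 * j + 1)" using k(1) by (simp add: K_def)
        then have "d dvd 2 * j + 1" by (simp only: int_dvd_int_iff)
        then obtain m where m: "2 * j + 1 = d * m" by (elim dvdE)
        have "odd (d * m)" unfolding m[symmetric] by simp
        then have "odd m" by simp
        then obtain t where "m = 2 * t + 1" by (elim oddE)
        moreover obtain c where "d = 2 * c + 1" using assms by (elim oddE)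
        ultimately have "j = c + d * t" "d div 2 = c" using m by (auto simp: algebra_simps)
        then show ?thesis using False by (auto simp: r_def)
      qed
      then obtain t where t: "j = r + d * t" by blast
      have "t \<le> d * t" using d by simp
      also have "\<dots> \<le> k" using t j by simp
      also have "\<dots> \<le> n" using k(1) by (simp add: K_def)
      finally have "t < Suc n" by simp
      then show ?thesis using j t by blast
    qed
    then show thesis using that by blast
  qed
  have "(\<Sum>k\<in>K \<inter> {h..}. n choose k) \<le> (\<Sum>k\<in>(\<lambda>t. h + (r + d * t)) ` {..<Suc n}. n choose k)"
    by (rule sum_mono2) (use r in auto)
  also have "\<dots> = (\<Sum>t<Suc n. g (r + d * t))"
    by (subst sum.reindex) (use d in \<open>auto simp: inj_on_def g_def\<close>)
  finally have "d * (\<Sum>k\<in>K \<inter> {h..}. n choose k) \<le> d * (\<Sum>t<Suc n. g (r + d * t))" by simp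
  also have "\<dots> \<le> d * g 0 + (\<Sum>j<r + d * Suc n. g j)"
    by (rule sum_antimono_progression[OF \<open>antimono g\<close>])
  \<comment> \<open>Beyond \<open>n div 2\<close> the index \<open>h + j\<close> exceeds
    \<open>n\<close> and the coefficient vanishes.\<close>
  also have "(\<Sum>j<r + d * Suc n. g j) = (\<Sum>j\<le>n div 2. g j)"
  proof (rule sum.mono_neutral_right)
    have "n \<le> d * n" using d by simp
    moreover have "n div 2 \<le> n" by simp
    ultimately have "n div 2 < r + d * Suc n" unfolding mult_Suc_right using d by linarith
    then show "{..n div 2} \<subseteq> {..<r + d * Suc n}" by auto
  qed (auto simp: g_def h_def)
  finally have right: "d * (\<Sum>k\<in>K \<inter> {h..}. n choose k) \<le> d * g 0 + (\<Sum>j\<le>n div 2. g j)" .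
  \<comment> \<open>The upper half and its mirror image together cover the row, sharing the central
    coefficient when \<open>n\<close> is even; \<open>g 0\<close> pays for this overlap.\<close>
  have "2 * (\<Sum>j\<le>n div 2. g j) \<le> 2 ^ n + g 0"
  proof -
    have up: "(\<Sum>j\<le>n div 2. g j) = (\<Sum>k\<in>{h..n}. n choose k)"
      by (rule sum.reindex_bij_witness[of _ "\<lambda>k. k - h" "\<lambda>j. h + j"]) (auto simp: g_def h_def)
    also have down: "\<dots> = (\<Sum>k\<in>{..n div 2}. n choose k)"
      by (rule sum.reindex_bij_witness[of _ "\<lambda>k. n - k" "\<lambda>k. n - k"])
        (auto simp: h_def binomial_symmetric[symmetric])
    also have "\<dots> \<le> (\<Sum>k\<in>insert h {..<h}. n choose k)"
      by (rule sum_mono2) (auto simp: h_def)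
    also have "\<dots> = g 0 + (\<Sum>k<h. n choose k)" by (simp add: g_def)
    finally have "2 * (\<Sum>j\<le>n div 2. g j) \<le> g 0 + ((\<Sum>k<h. n choose k) + (\<Sum>k\<in>{h..n}. n choose k))"
      using up by simp
    also have "(\<Sum>k<h. n choose k) + (\<Sum>k\<in>{h..n}. n choose k) = (\<Sum>k\<le>n. n choose k)"
      by (subst sum.union_disjoint[symmetric]) (auto intro!: sum.cong simp: h_def)
    finally show ?thesis by (simp add: choose_row_sum)
  qed
  then have "d * (\<Sum>k\<in>K. n choose k) \<le> 2 * (d * g 0) + (2 ^ n + g 0)"
    using right mult_le_mono2[OF half, of d] by linarith
  also have "\<dots> \<le> 2 ^ n + 3 * d * g 0" using mult_le_mono1[OF d, of "g 0"] by simp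
  finally show ?thesis by (simp only: K_def g0)
qed

section \<open>Size of the central binomial coefficients\<close>

text \<open>The sequence \<open>(2 * m + 1) * c^2 / 16^m\<close>, with \<open>c\<close> the central
  coefficient, starts at 1 and never increases: its successive ratio is
  \<open>(2 * m + 1) * (2 * m + 3) / (2 * m + 2)^2\<close>, which is below 1.\<close>

lemma central_binomial_upper_bound: "real ((2 * m) choose m) \<le> 4 ^ m / sqrt (2 * m + 1)"
proof -
  have "(2 * real m + 1) * (real ((2 * m) choose m))\<^sup>2 \<le> 16 ^ m"
  proof (induction m)
    case (Suc m)
    define c where "c = real ((2 * m) choose m)"
    have "Suc m * ((2 * Suc m) choose Suc m) = 2 * (2 * m + 1) * ((2 * m) choose m)"
    proof -
      have "Suc m * (Suc (2 * m) choose Suc m) = Suc (2 * m) * ((2 * m) choose m)"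
        by (rule Suc_times_binomial)
      moreover have "(2 * Suc m) choose Suc m = 2 * (Suc (2 * m) choose Suc m)"
        using binomial_symmetric[of m "Suc (2 * m)"] by simp
      ultimately show ?thesis by (simp only: mult.left_commute[of "Suc m"] mult.assoc Suc_eq_plus1)
    qed
    then have "real (Suc m * ((2 * Suc m) choose Suc m)) = real (2 * (2 * m + 1) * ((2 * m) choose m))"
      by (simp only:)
    then have rec: "real ((2 * Suc m) choose Suc m) = 2 * (2 * real m + 1) * c / (real m + 1)"
      by (simp add: c_def field_simps)
    have "(2 * real (Suc m) + 1) * (real ((2 * Suc m) choose Suc m))\<^sup>2
        = 4 * (2 * real m + 3) * (2 * real m + 1) / (real m + 1)\<^sup>2 * ((2 * real m + 1) * c\<^sup>2)"
      unfolding rec by (simp add: power2_eq_square field_simps)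
    also have "\<dots> \<le> 16 * 16 ^ m"
    proof (rule mult_mono)
      show "4 * (2 * real m + 3) * (2 * real m + 1) / (real m + 1)\<^sup>2 \<le> 16"
        proof -
        have "0 \<le> real m * real m" by simp
        then have "4 * (2 * real m + 3) * (2 * real m + 1) \<le> 16 * (real m + 1)\<^sup>2"
          by (simp add: power2_eq_square algebra_simps)
        then show ?thesis by (subst pos_divide_le_eq) (simp_all add: zero_less_power)
      qed
      show "(2 * real m + 1) * c\<^sup>2 \<le> 16 ^ m" using Suc by (simp add: c_def)
    qed auto
    finally show ?case by simp
  qed simp
  then have "(sqrt (2 * m + 1) * real ((2 * m) choose m))\<^sup>2 \<le> (4 ^ m)\<^sup>2"
    by (simp add: power_mult_distrib add.commute) (simp add: power2_eq_square power_mult_distrib[symmetric])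
  then have "sqrt (2 * m + 1) * real ((2 * m) choose m) \<le> 4 ^ m"
    by (rule power2_le_imp_le) simp
  moreover have "sqrt (2 * m + 1) > 0" by simp
  ultimately show ?thesis by (simp add: pos_le_divide_eq mult.commute)
qed

lemma binomial_half_upper_bound: "real (n choose (n div 2)) \<le> 2 ^ n / sqrt (n + 1)"
proof (cases "even n")
  case True
  then obtain m where "n = 2 * m" by (elim evenE)
  then show ?thesis using central_binomial_upper_bound[of m] by (simp add: power_mult)
next
  case False
  then obtain m where n: "n = 2 * m + 1" by (elim oddE)
  \<comment> \<open>An odd row is bounded through the next even one, whose central coefficient is
    twice as large.\<close>
  have "(2 * Suc m) choose Suc m = 2 * (n choose m)"
    using binomial_symmetric[of m "Suc (2 * m)"] n by simp
  then have "2 * real (n choose m) \<le> 4 ^ Suc m / sqrt (2 * Suc m + 1)"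
    using central_binomial_upper_bound[of "Suc m"] by simp
  also have "\<dots> \<le> 4 ^ Suc m / sqrt (n + 1)"
    by (rule divide_left_mono) (auto simp: n)
  also have "\<dots> = 2 * (2 ^ n / sqrt (n + 1))" by (simp add: n power_mult)
  finally show ?thesis by (simp add: n)
qed

text \<open>The powers of 2 dominate, so the sum is comparable to its last term. The constant 4
  closes the induction: replacing \<open>s + 1\<close> by \<open>s + 2\<close> under the root costs
  a factor of at most 3/2, turning 4 into 6, and the new term adds 2, giving
  \<open>8 * 2 ^ s\<close>.\<close>

lemma sum_binomial_half: "(\<Sum>n\<le>s. real (n choose (n div 2))) \<le> 4 * 2 ^ s / sqrt (s + 1)"
proof (induction s)
  case (Suc s)
  have "sqrt (s + 2) \<le> sqrt (9 / 4 * (s + 1))" by (simp only: real_sqrt_le_iff) simp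
  also have "\<dots> = 3 / 2 * sqrt (s + 1)" by (subst real_sqrt_mult) (simp add: real_sqrt_divide)
  finally have "1 / sqrt (s + 1) \<le> 3 / 2 / sqrt (s + 2)" by (simp add: field_simps)
  then have "4 * 2 ^ s * (1 / sqrt (s + 1)) \<le> 4 * 2 ^ s * (3 / 2 / sqrt (s + 2))"
    by (rule mult_left_mono) simp
  moreover have "real (Suc s choose (Suc s div 2)) \<le> 2 ^ Suc s / sqrt (s + 2)"
    using binomial_half_upper_bound[of "Suc s"] by (simp add: add.commute)
  ultimately have "(\<Sum>n\<le>Suc s. real (n choose (n div 2)))
      \<le> 6 * 2 ^ s / sqrt (s + 2) + 2 ^ Suc s / sqrt (s + 2)"
    using Suc by simp
  also have "\<dots> = 4 * 2 ^ Suc s / sqrt (Suc s + 1)"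
    by (simp add: add_divide_distrib[symmetric] add.commute)
  finally show ?case .
qed simp

subsection \<open>Density bounds\<close>

text \<open>Distinct words give distinct identities, so presentations may be counted as two-element
  sets of words.\<close>

lemma density_upto_eq:
  "density_upto \<phi> s =
    real (card {J. J \<subseteq> words_upto s \<and> card J = 2 \<and> models (presented_struct (identity ` J)) \<phi>})
      / real (card (words_upto s) choose 2)"
proof -
  have card_img: "card (identity ` J) = card J" for J
    by (rule card_image) (rule inj_on_subset[OF inj_identity subset_UNIV])
  have inj: "inj_on ((`) identity) A" for A
    using inj_image_eq_iff[OF inj_identity] by (auto simp: inj_on_def)
  have pres: "presentations s = (`) identity ` {J. J \<subseteq> words_upto s \<and> card J = 2}"
    unfolding presentations_def words_upto_def[symmetric]
    by (auto simp: subset_image_iff card_img)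
  then have "{I \<in> presentations s. models (presented_struct I) \<phi>}
      = (`) identity ` {J. J \<subseteq> words_upto s \<and> card J = 2 \<and> models (presented_struct (identity ` J)) \<phi>}"
    by auto
  then show ?thesis
    unfolding density_upto_def pres by (simp add: card_image[OF inj] n_subsets)
qed

lemma one_cycle_pair_iff:
  assumes "card J = 2"
  shows "models (presented_struct (identity ` J)) one_cycle \<longleftrightarrow> Gcd (exponent ` J) = 1"
proof -
  obtain u v where "J = {u, v}" using assms by (auto simp: card_2_iff)
  then show ?thesis by (simp add: one_cycle_iff_gcd)
qed

lemma real_choose_two: "real (n choose 2) = real n * (real n - 1) / 2"
proof (induction n)
  case (Suc n)
  have "Suc n choose 2 = n + (n choose 2)" by (simp add: numeral_2_eq_2)
  then show ?case using Suc by (simp add: field_simps)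
qed (simp add: numeral_2_eq_2)

text \<open>Drawing two words without replacement hits a given set no more often than two
  independent draws do, because \<open>(x - 1) / (n - 1)\<close> is at most
  \<open>x / n\<close>.\<close>

lemma choose_two_ratio_le:
  assumes "x \<le> n" "n \<ge> 2"
  shows "real (x choose 2) / real (n choose 2) \<le> (real x / real n)\<^sup>2"
proof -
  have "real (x choose 2) / real (n choose 2) = real x / real n * ((real x - 1) / (real n - 1))"
    by (simp add: real_choose_two)
  also have "\<dots> \<le> real x / real n * (real x / real n)"
  proof (rule mult_left_mono)
    show "(real x - 1) / (real n - 1) \<le> real x / real n"
      using assms by (subst frac_le_eq) (auto simp: algebra_simps intro!: divide_nonpos_pos)
  qed simp
  finally show ?thesis by (simp add: power2_eq_square)
qed

section \<open>The parity obstruction\<close>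

definition even_words :: "nat \<Rightarrow> symb list set" where
  "even_words s = {w \<in> words_upto s. even (length w)}"

lemma even_exponent_iff: "even (exponent w) \<longleftrightarrow> even (length w)"
  by (simp add: exponent_eq_count)

lemma card_words_upto_filter:
  "card {w \<in> words_upto s. P w} = (\<Sum>n\<le>s. card {w \<in> words n. P w})"
  unfolding card_filter_eq_sum[OF finite_words_upto] card_filter_eq_sum[OF finite_words]
  by (rule sum_words_upto)

text \<open>A geometric sum with ratio 4, unchanged by adding the odd length
  \<open>2 * m + 1\<close>. Against totals of \<open>2 * 4 ^ m - 1\<close> and
  \<open>4 ^ Suc m - 1\<close> this is about two thirds and exactly one third; the oscillation of
  the density comes from this gap.\<close>

lemma card_even_words:
  "3 * card (even_words (2 * m)) + 1 = 4 ^ Suc m"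
  "3 * card (even_words (2 * m + 1)) + 1 = 4 ^ Suc m"
proof -
  have "{w \<in> words n. even (length w)} = (if even n then words n else {})" for n
    by (auto simp: words_def)
  then have card: "card (even_words s) = (\<Sum>n\<le>s. if even n then 2 ^ n else 0)" for s
    unfolding even_words_def card_words_upto_filter by (intro sum.cong) (simp_all add: card_words)
  show "3 * card (even_words (2 * m)) + 1 = 4 ^ Suc m"
    unfolding card by (induction m) (simp_all add: power_mult)
  then show "3 * card (even_words (2 * m + 1)) + 1 = 4 ^ Suc m"
    unfolding card by simp
qed

text \<open>Two words of even length have an even gcd of exponents and so never present a 1-cycle;
  such pairs make up at least 4/9 of all pairs.\<close>

lemma density_even_le:
  assumes "m \<ge> 1"
  shows "density_upto one_cycle (2 * m) \<le> 5 / 9"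
proof -
  define W where "W = words_upto (2 * m)"
  define N where "N = card W"
  define E where "E = card (even_words (2 * m))"
  define x where "x = (4::real) ^ m"
  have x: "x \<ge> 4" unfolding x_def using power_increasing[OF assms, of "4::real"] by simp
  have finW: "finite W" by (simp add: W_def)
  have sub: "even_words (2 * m) \<subseteq> W" by (auto simp: even_words_def W_def)
  have E: "real E = (4 * x - 1) / 3"
    using arg_cong[OF card_even_words(1)[of m], of real] by (simp add: E_def x_def)
  have N: "real N = 2 * x - 1"
    by (simp add: N_def W_def card_words_upto x_def power_mult of_nat_diff)
  have "{J. J \<subseteq> W \<and> card J = 2 \<and> models (presented_struct (identity ` J)) one_cycle}
      \<subseteq> {J. J \<subseteq> W \<and> card J = 2} - {J. J \<subseteq> even_words (2 * m) \<and> card J = 2}"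
  proof safe
    fix J assume J: "card J = 2" "J \<subseteq> even_words (2 * m)"
      and cyc: "models (presented_struct (identity ` J)) one_cycle"
    have "2 dvd Gcd (exponent ` J)"
      using J(2) by (intro Gcd_greatest) (auto simp: even_words_def even_exponent_iff)
    then show False using one_cycle_pair_iff[OF J(1)] cyc by simp
  qed
  then have "card {J. J \<subseteq> W \<and> card J = 2 \<and> models (presented_struct (identity ` J)) one_cycle}
      \<le> card ({J. J \<subseteq> W \<and> card J = 2} - {J. J \<subseteq> even_words (2 * m) \<and> card J = 2})"
    by (rule card_mono[rotated]) (use finW in simp)
  also have "\<dots> = (N choose 2) - (E choose 2)"
    using sub finW finite_subset[OF sub finW]
    by (subst card_Diff_subset) (auto simp: n_subsets N_def E_def)
  finally have "real (card {J. J \<subseteq> W \<and> card J = 2 \<and> models (presented_struct (identity ` J)) one_cycle})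
      \<le> real ((N choose 2) - (E choose 2))" by simp
  also have "\<dots> = real (N choose 2) - real (E choose 2)"
    by (rule of_nat_diff) (simp add: N_def E_def card_mono[OF finW sub] binomial_right_mono)
  also have "\<dots> \<le> 5 / 9 * real (N choose 2)"
  proof -
    \<comment> \<open>Both binomials are brought to a form with the common factor
      \<open>4 * x - 4\<close>, so only \<open>4 * x - 2\<close> and \<open>4 * x - 1\<close> are
      compared.\<close>
    have "4 / 9 * real (N choose 2) = (4 * x - 2) * (4 * x - 4) / 18"
      unfolding real_choose_two N by (simp add: field_simps)
    also have "\<dots> \<le> (4 * x - 1) * (4 * x - 4) / 18"
      using x by (intro divide_right_mono mult_right_mono) auto
    also have "\<dots> = real (E choose 2)"
      unfolding real_choose_two E by (simp add: field_simps)
    finally show ?thesis by simp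
  qed
  finally show ?thesis
    unfolding density_upto_eq W_def[symmetric] N_def[symmetric]
    by (intro divide_le_eq[THEN iffD2]) (auto simp: real_choose_two N intro: x)
qed

section \<open>Counting the failing pairs for odd bounds on the length\<close>

text \<open>The bound for each length is summed over all lengths. The constant 12 is the 3 of the
  progression bound times the 4 of the central binomial sum.\<close>

lemma card_dvd_exponent_le:
  fixes d :: nat
  assumes "odd d"
  shows "real (card {w \<in> words_upto s. int d dvd exponent w})
    \<le> real (card (words_upto s)) * (1 / d + 12 / sqrt (s + 1))"
proof -
  have d: "d > 0" using assms by (cases d) auto
  have "d * card {w \<in> words_upto s. int d dvd exponent w}
      = (\<Sum>n\<le>s. d * card {w \<in> words n. int d dvd exponent w})"
    by (simp add: card_words_upto_filter sum_distrib_left)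
  also have "\<dots> \<le> (\<Sum>n\<le>s. 2 ^ n + 3 * d * (n choose (n div 2)))"
    unfolding card_words_dvd_exponent by (intro sum_mono sum_binomial_progression assms)
  also have "\<dots> = card (words_upto s) + 3 * d * (\<Sum>n\<le>s. n choose (n div 2))"
    using card_words_upto_filter[of s "\<lambda>_. True"] by (simp add: card_words sum.distrib sum_distrib_left)
  finally have "real (d * card {w \<in> words_upto s. int d dvd exponent w})
      \<le> real (card (words_upto s) + 3 * d * (\<Sum>n\<le>s. n choose (n div 2)))"
    by (simp only: of_nat_le_iff)
  also have "\<dots> \<le> real (card (words_upto s)) + 3 * d * (4 * 2 ^ s / sqrt (s + 1))"
    using mult_left_mono[OF sum_binomial_half[of s], of "3 * real d"] by simp
  also have "\<dots> \<le> real (card (words_upto s)) + 3 * d * (4 * real (card (words_upto s)) / sqrt (s + 1))"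
    by (intro add_left_mono mult_left_mono divide_right_mono) (auto simp: card_words_upto of_nat_diff)
  also have "\<dots> = d * (real (card (words_upto s)) * (1 / d + 12 / sqrt (s + 1)))"
    using d by (simp add: field_simps)
  finally show ?thesis using d by (simp add: add.commute)
qed

lemma card_zero_exponent_le:
  "real (card {w \<in> words_upto s. exponent w = 0}) \<le> real (card (words_upto s)) * (4 / sqrt (s + 1))"
proof -
  have "card {w \<in> words n. exponent w = 0} \<le> n choose (n div 2)" for n
  proof -
    have "card {w \<in> words n. exponent w = 0} = (\<Sum>k | k \<le> n \<and> 2 * int k - int n = 0. n choose k)"
      \<comment> \<open>Only 0 is divisible by 0, so the divisibility count with divisor 0 counts
        exponent 0.\<close>
      using card_words_dvd_exponent[of n 0] by simp
    also have "\<dots> \<le> (\<Sum>k\<in>{n div 2}. n choose k)"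
      by (rule sum_mono2) auto
    finally show ?thesis by simp
  qed
  then have "card {w \<in> words_upto s. exponent w = 0} \<le> (\<Sum>n\<le>s. n choose (n div 2))"
    unfolding card_words_upto_filter by (intro sum_mono)
  then have "real (card {w \<in> words_upto s. exponent w = 0}) \<le> real (\<Sum>n\<le>s. n choose (n div 2))"
    by (simp only: of_nat_le_iff)
  also have "\<dots> \<le> 4 * 2 ^ s / sqrt (s + 1)" using sum_binomial_half[of s] by simp
  also have "\<dots> \<le> 4 * real (card (words_upto s)) / sqrt (s + 1)"
    by (intro mult_left_mono divide_right_mono) (auto simp: card_words_upto of_nat_diff)
  finally show ?thesis by (simp add: mult.commute)
qed

text \<open>Telescoping, from \<open>(2 * k + 3)^2 >= 4 * (k + 1) * (k + 2)\<close>.\<close>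

lemma sum_inverse_odd_squares_le:
  "(\<Sum>d | odd d \<and> 3 \<le> d \<and> d \<le> M. 1 / (real d)\<^sup>2) \<le> 1 / 4"
proof -
  have telescope: "(\<Sum>k<K. 1 / (2 * real k + 3)\<^sup>2) \<le> 1 / 4 - 1 / (4 * (real K + 1))" for K
  proof (induction K)
    case (Suc K)
    have "1 / (2 * real K + 3)\<^sup>2 \<le> 1 / (4 * (real K + 1) * (real K + 2))"
      by (rule divide_left_mono) (simp_all add: power2_eq_square algebra_simps add_pos_nonneg)
    also have "\<dots> = 1 / ((real K + 1) * (real K + 2)) / 4" by (simp only: divide_divide_eq_left ac_simps)
    also have "1 / ((real K + 1) * (real K + 2)) = 1 / (real K + 1) - 1 / (real K + 2)"
      by (subst diff_frac_eq) (simp_all add: add_pos_nonneg)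
    also have "\<dots> / 4 = 1 / (4 * (real K + 1)) - 1 / (4 * (real K + 2))"
      by (simp add: diff_divide_distrib mult.commute)
    finally show ?case using Suc by (simp add: add.commute)
  qed simp
  have "{d. odd d \<and> 3 \<le> d \<and> d \<le> M} \<subseteq> (\<lambda>k. 2 * k + 3) ` {..<M}"
  proof
    fix d assume "d \<in> {d. odd d \<and> 3 \<le> d \<and> d \<le> M}"
    then have "d = 2 * ((d - 3) div 2) + 3" "(d - 3) div 2 < M" by (auto elim!: oddE)
    then show "d \<in> (\<lambda>k. 2 * k + 3) ` {..<M}" by blast
  qed
  then have "(\<Sum>d | odd d \<and> 3 \<le> d \<and> d \<le> M. 1 / (real d)\<^sup>2)
      \<le> (\<Sum>d\<in>(\<lambda>k. 2 * k + 3) ` {..<M}. 1 / (real d)\<^sup>2)"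
    by (intro sum_mono2) auto
  also have "\<dots> = (\<Sum>k<M. 1 / (2 * real k + 3)\<^sup>2)"
    by (subst sum.reindex) (auto simp: inj_on_def)
  also have "\<dots> \<le> 1 / 4 - 1 / (4 * (real M + 1))" by (rule telescope)
  also have "\<dots> \<le> 1 / 4" by simp
  finally show ?thesis .
qed

text \<open>Failing pairs are sorted by their gcd \<open>d\<close>. If both words lie in
  \<open>Z\<close>, the pair is rare. Otherwise some exponent is nonzero and at most
  \<open>8 * q\<close> in absolute value, so \<open>d\<close> lies between 1 and
  \<open>8 * q\<close>; being different from 1, it is even or an odd number from 3 on. A union bound
  adds the squared proportions.\<close>

lemma density_odd_ge:
  fixes q :: nat
  assumes q: "q \<ge> 1"
  shows "density_upto one_cycle (4 * q\<^sup>2 - 1)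
    \<ge> 1 - 1 / 9 - (1 / 16 + 2 / q)\<^sup>2 - 9 / 32 - 2592 / q"
proof -
  define s where "s = 4 * q\<^sup>2 - 1"
  define W where "W = words_upto s"
  define N where "N = card W"
  \<comment> \<open>\<open>4 * q\<^sup>2\<close> makes \<open>sqrt (s + 1)\<close> an integer, and \<open>8 * q\<close> is four standard deviations.\<close>
  define Z where "Z = {w \<in> W. exponent w = 0} \<union> {w \<in> W. \<bar>exponent w\<bar> > real (8 * q)}"
  define D where "D = {d. odd d \<and> 3 \<le> d \<and> d \<le> 8 * q}"
  define V where "V d = {w \<in> W. int d dvd exponent w}" for d
  define pairs where "pairs X = {J. J \<subseteq> X \<and> card J = 2}" for X :: "symb list set"
  have q2: "q\<^sup>2 \<ge> 1" using q by simp
  have root: "sqrt (s + 1) = 2 * q"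
  proof -
    have "s + 1 = (2 * q)\<^sup>2" using q2 by (simp add: s_def power_mult_distrib)
    then show ?thesis by (simp only: of_nat_power real_sqrt_abs)
  qed
  have finW [simp]: "finite W" by (simp add: W_def)
  \<comment> \<open>Separates the main term \<open>1 / d\<close> from the error term. The weight 9/8
    keeps the loss in the main sum small, while the factor 9 falls on a vanishing error.\<close>
  have young: "(a + b)\<^sup>2 \<le> 9 / 8 * a\<^sup>2 + 9 * b\<^sup>2" for a b :: real
  proof -
    have "0 \<le> (a - 8 * b)\<^sup>2" by simp
    then show ?thesis by (simp add: power2_eq_square algebra_simps)
  qed
  have N2: "N \<ge> 2"
  proof -
    have "s \<ge> 1" using q2 by (simp add: s_def)
    then have "(2::nat) ^ Suc 1 \<le> 2 ^ Suc s" by (intro power_increasing) auto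
    then show ?thesis by (simp add: N_def W_def card_words_upto)
  qed
  have ratio: "real (card (pairs X)) / real (N choose 2) \<le> c\<^sup>2"
    if "X \<subseteq> W" "real (card X) \<le> real N * c" for X c
  proof -
    have "card (pairs X) = card X choose 2"
      using that(1) by (simp add: pairs_def n_subsets finite_subset)
    then have "real (card (pairs X)) / real (N choose 2) \<le> (real (card X) / real N)\<^sup>2"
      using choose_two_ratio_le[of "card X" N] N2 that(1) by (simp add: N_def card_mono)
    also have "\<dots> \<le> c\<^sup>2"
      using that(2) N2 by (intro power_mono) (simp_all add: pos_divide_le_eq mult.commute)
    finally show ?thesis .
  qed
  have fin [simp]: "finite (pairs X)" if "X \<subseteq> W" for X
    using that by (simp add: pairs_def finite_subset)
  have finD [simp]: "finite D" by (rule finite_subset[of _ "{..8 * q}"]) (auto simp: D_def)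
  have sub: "even_words s \<subseteq> W" "Z \<subseteq> W" "V d \<subseteq> W" for d
    by (auto simp: even_words_def W_def Z_def V_def)
  have bad: "J \<in> pairs (even_words s) \<union> pairs Z \<union> (\<Union>d\<in>D. pairs (V d))"
    if J: "J \<in> pairs W" and not_cyc: "\<not> models (presented_struct (identity ` J)) one_cycle" for J
  proof (cases "J \<subseteq> Z")
    case False
    define d where "d = nat (Gcd (exponent ` J))"
    have dvd: "int d dvd exponent w" if "w \<in> J" for w
      using that by (simp add: d_def Gcd_int_greater_eq_0)
    have d1: "d \<noteq> 1"
      using one_cycle_pair_iff[of J] J not_cyc by (auto simp: pairs_def d_def)
    obtain w where "w \<in> J" "w \<notin> Z" using False by blast
    then have w: "w \<in> J" "exponent w \<noteq> 0" "real_of_int \<bar>exponent w\<bar> \<le> real (8 * q)"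
      using J by (auto simp: Z_def pairs_def not_less)
    have d0: "d \<noteq> 0" using dvd[OF w(1)] w(2) by auto
    have "int d \<le> \<bar>exponent w\<bar>" using dvd_imp_le_int[OF w(2) dvd[OF w(1)]] by simp
    then have "d \<le> 8 * q" using w(3) by linarith
    show ?thesis
    proof (cases "even d")
      case True
      then have "even (exponent w)" if "w \<in> J" for w
        using dvd[OF that] by (metis dvd_trans even_of_nat)
      then show ?thesis using J by (auto simp: pairs_def even_words_def W_def even_exponent_iff)
    next
      case False
      then have "d \<in> D" using d0 d1 \<open>d \<le> 8 * q\<close> by (auto simp: D_def elim!: oddE)
      moreover have "J \<in> pairs (V d)" using J dvd by (auto simp: pairs_def V_def)
      ultimately show ?thesis by blast
    qed
  qed (use J in \<open>auto simp: pairs_def\<close>)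
  let ?good = "{J. J \<subseteq> W \<and> card J = 2 \<and> models (presented_struct (identity ` J)) one_cycle}"
  have "pairs W \<subseteq> ?good \<union> (pairs (even_words s) \<union> pairs Z \<union> (\<Union>d\<in>D. pairs (V d)))"
    using bad by (auto simp: pairs_def)
  then have "card (pairs W) \<le> card (?good \<union> (pairs (even_words s) \<union> pairs Z \<union> (\<Union>d\<in>D. pairs (V d))))"
    by (rule card_mono[rotated]) (simp add: sub)
  also have "\<dots> \<le> card ?good + (card (pairs (even_words s)) + card (pairs Z) + (\<Sum>d\<in>D. card (pairs (V d))))"
    by (intro order_trans[OF card_Un_le] add_mono card_UN_le finD order_refl)
  finally have "real (card (pairs W)) \<le> real (card ?good
      + (card (pairs (even_words s)) + card (pairs Z) + (\<Sum>d\<in>D. card (pairs (V d)))))"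
    by (simp only: of_nat_le_iff)
  moreover have cardW: "card (pairs W) = N choose 2" by (simp add: pairs_def n_subsets N_def)
  moreover have "real (N choose 2) > 0" using N2 by simp
  ultimately have "1 \<le> real (card ?good) / real (N choose 2)
      + (real (card (pairs (even_words s))) / real (N choose 2) + real (card (pairs Z)) / real (N choose 2)
        + (\<Sum>d\<in>D. real (card (pairs (V d))) / real (N choose 2)))"
    by (simp add: sum_divide_distrib[symmetric] add_divide_distrib[symmetric])
  moreover have "real (card ?good) / real (N choose 2) = density_upto one_cycle s"
    by (simp add: density_upto_eq W_def N_def)
  moreover have "real (card (pairs (even_words s))) / real (N choose 2) \<le> (1 / 3)\<^sup>2"
  proof (rule ratio[OF sub(1)])
    have s: "s = 2 * (2 * q\<^sup>2 - 1) + 1" using q2 by (simp add: s_def)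
    have "3 * card (even_words s) + 1 = 4 ^ Suc (2 * q\<^sup>2 - 1)"
      unfolding s by (rule card_even_words(2))
    also have "\<dots> = 2 ^ Suc s" unfolding s by (simp add: power_mult)
    finally have "3 * card (even_words s) = N" by (simp add: N_def W_def card_words_upto)
    then show "real (card (even_words s)) \<le> real N * (1 / 3)" by simp
  qed
  moreover have "real (card (pairs Z)) / real (N choose 2) \<le> (1 / 16 + 2 / q)\<^sup>2"
  proof (rule ratio[OF sub(2)])
    have "(real (8 * q))\<^sup>2 * real (card {w \<in> W. \<bar>exponent w\<bar> > real (8 * q)}) \<le> real s * real N"
      unfolding W_def N_def by (rule card_large_exponent) simp
    also have "\<dots> \<le> (4 * (real q)\<^sup>2) * real N"
    proof (rule mult_right_mono)
      have "real s \<le> real (4 * q\<^sup>2)" unfolding s_def by (simp only: of_nat_le_iff diff_le_self)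
      then show "real s \<le> 4 * (real q)\<^sup>2" by simp
    qed simp
    finally have "(4 * (real q)\<^sup>2) * (16 * real (card {w \<in> W. \<bar>exponent w\<bar> > real (8 * q)}))
        \<le> (4 * (real q)\<^sup>2) * real N"
      by (simp add: power_mult_distrib)
    \<comment> \<open>The threshold squared is 16 times the variance bound \<open>4 * q^2\<close>,
      so Chebyshev leaves a proportion of 1/16.\<close>
    then have "16 * real (card {w \<in> W. \<bar>exponent w\<bar> > real (8 * q)}) \<le> real N"
      using q by (subst (asm) mult_le_cancel_left_pos) auto
    moreover have "real (card {w \<in> W. exponent w = 0}) \<le> real N * (4 / (2 * q))"
      using card_zero_exponent_le[of s] root by (simp add: W_def N_def mult.commute)
    moreover have "real (card Z)
        \<le> real (card {w \<in> W. exponent w = 0}) + real (card {w \<in> W. \<bar>exponent w\<bar> > real (8 * q)})"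
      unfolding Z_def of_nat_add[symmetric] of_nat_le_iff by (rule card_Un_le)
    ultimately show "real (card Z) \<le> real N * (1 / 16 + 2 / q)"
      by (simp add: algebra_simps)
  qed
  moreover have "(\<Sum>d\<in>D. real (card (pairs (V d))) / real (N choose 2)) \<le> 9 / 32 + 2592 / q"
  proof -
    have "(\<Sum>d\<in>D. real (card (pairs (V d))) / real (N choose 2))
        \<le> (\<Sum>d\<in>D. 9 / 8 * (1 / (real d)\<^sup>2) + 324 / (real q)\<^sup>2)"
    proof (rule sum_mono)
      fix d assume "d \<in> D"
      then have "odd d" by (simp add: D_def)
      then have "real (card (V d)) \<le> real N * (1 / d + 12 / sqrt (s + 1))"
        using card_dvd_exponent_le[of d s] by (simp add: V_def W_def N_def add.commute)
      then have "real (card (pairs (V d))) / real (N choose 2) \<le> (1 / d + 12 / sqrt (s + 1))\<^sup>2"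
        by (rule ratio[OF sub(3)])
      also have "\<dots> = (1 / d + 6 / q)\<^sup>2" unfolding root by simp
      also have "\<dots> \<le> 9 / 8 * (1 / d)\<^sup>2 + 9 * (6 / q)\<^sup>2"
        by (rule young)
      finally show "real (card (pairs (V d))) / real (N choose 2)
          \<le> 9 / 8 * (1 / (real d)\<^sup>2) + 324 / (real q)\<^sup>2"
        by (simp add: power_divide)
    qed
    also have "\<dots> = 9 / 8 * (\<Sum>d\<in>D. 1 / (real d)\<^sup>2) + real (card D) * (324 / (real q)\<^sup>2)"
      by (simp add: sum.distrib sum_distrib_left)
    also have "\<dots> \<le> 9 / 8 * (1 / 4) + real (8 * q) * (324 / (real q)\<^sup>2)"
    proof (intro add_mono mult_left_mono mult_right_mono)
      show "(\<Sum>d\<in>D. 1 / (real d)\<^sup>2) \<le> 1 / 4"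
        unfolding D_def by (rule sum_inverse_odd_squares_le)
      have "card D \<le> card {1..8 * q}" by (rule card_mono) (auto simp: D_def)
      then show "real (card D) \<le> real (8 * q)" by simp
    qed auto
    \<comment> \<open>There are at most \<open>8 * q\<close> divisors, each with error
      \<open>324 / q^2\<close>; cutting them off at order \<open>q\<close> is what makes the total
      error vanish.\<close>
    also have "\<dots> = 9 / 32 + 2592 / q" using q by (simp add: power2_eq_square)
    finally show ?thesis .
  qed
  ultimately have "1 - 1 / 9 - (1 / 16 + 2 / q)\<^sup>2 - 9 / 32 - 2592 / q \<le> density_upto one_cycle s"
    using power_divide[of "1::real" 3 2] by simp
  then show ?thesis by (simp add: s_def)
qed

theorem proposition3p16:
  shows "\<not> has_limiting_density one_cycle"
proof
  assume "has_limiting_density one_cycle"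
  then obtain d where lim: "density_upto one_cycle \<longlonglongrightarrow> d"
    by (auto simp: has_limiting_density_def)
  have "strict_mono (\<lambda>m::nat. 2 * m)" by (simp add: strict_mono_def)
  from LIMSEQ_subseq_LIMSEQ[OF lim this]
  have "(\<lambda>m. density_upto one_cycle (2 * m)) \<longlonglongrightarrow> d" by (simp add: o_def)
  then have "d \<le> 5 / 9"
    by (rule LIMSEQ_le_const2) (use density_even_le in blast)
  \<comment> \<open>The left-hand side is about 0.603, above 5/9.\<close>
  moreover have "1 - 1 / 9 - (1 / 16 + 0)\<^sup>2 - 9 / 32 - 0 \<le> d"
  proof (rule LIMSEQ_le)
    show "(\<lambda>q. 1 - 1 / 9 - (1 / 16 + 2 / real q)\<^sup>2 - 9 / 32 - 2592 / real q)
        \<longlonglongrightarrow> 1 - 1 / 9 - (1 / 16 + 0)\<^sup>2 - 9 / 32 - (0::real)"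
      by (intro tendsto_intros lim_const_over_n)
    have "filterlim (\<lambda>q::nat. 4 * q\<^sup>2 - 1) at_top sequentially"
    proof (rule filterlim_at_top_mono[OF filterlim_ident])
      \<comment> \<open>Truncated subtraction makes the right-hand side 0 at \<open>q = 0\<close>,
        so that case is separate.\<close>
      have "q \<le> 4 * q\<^sup>2 - 1" for q :: nat
      proof (cases "q = 0")
        case False
        then have "q * 1 \<le> q * q" by (intro mult_le_mono2) simp
        then show ?thesis using False unfolding power2_eq_square by linarith
      qed simp
      then show "\<forall>\<^sub>F q in sequentially. q \<le> 4 * q\<^sup>2 - 1" by simp
    qed
    from filterlim_compose[OF lim this]
    show "(\<lambda>q. density_upto one_cycle (4 * q\<^sup>2 - 1)) \<longlonglongrightarrow> d" .
    show "\<exists>K. \<forall>q\<ge>K. 1 - 1 / 9 - (1 / 16 + 2 / real q)\<^sup>2 - 9 / 32 - 2592 / real q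
        \<le> density_upto one_cycle (4 * q\<^sup>2 - 1)"
      using density_odd_ge by blast
  qed
  ultimately show False by (simp add: power2_eq_square)
qed

end
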